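(* A polynomial $u\in\mathbb{Z}[x]$ is nilpotent at $-2$ (that is, $u\in N_{-2}$) if and only if it has one of the following forms for some $p(x)\in\mathbb{Z}[x]$, and in each case the index of nilpotency at $-2$ and the associated finite sequence at $-2$ are as stated: (1) $(x+2)p(x)$ (index $1$, associated finite sequence $-2,0$); (2) $x+1+p(x)(x+1)(x+2)$ (index $2$, associated finite sequence $-2,-1,0$); (3) $-2(x+4)+p(x)(x+2)(x+4)$ (index $2$, associated finite sequence $-2,-4,0$); (4) $-3(x+3)+p(x)(x+2)(x+3)$ (index $2$, associated finite sequence $-2,-3,0$); (5) $(x+1)(x+6)+p(x)(x+2)(x+4)(x+6)$ (index $3$, associated finite sequence $-2,-4,-6,0$); (6) $-(x+5)(x^2+4x+5)+p(x)(x+2)(x+3)(x+4)(x+5)$ (index $4$, associated finite sequence $-2,-3,-4,-5,0$).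
   Context: $\mathbb{N}$ is the set of positive integers. For $u\in\mathbb{Z}[x]$ and $n\in\mathbb{N}$, $u^{(n)}$ denotes the $n$-fold composition $u\circ\cdots\circ u$. For $r\in\mathbb{Z}$, $u$ is called nilpotent at $r$ if there is $n\in\mathbb{N}$ with $u^{(n)}(r)=0$; the smallest such $n$ is called the index (of nilpotency) of $u$ at $r$. The zero polynomial is nilpotent at every $r$ with index $1$. $N_r$ denotes the set of all $u\in\mathbb{Z}[x]$ nilpotent at $r$. If $u$ is nilpotent at $r$ of index $m$, the finite sequence associated to $u$ at $r$ is $r,u(r),\ldots,u^{(m-1)}(r),0$. *)

theory Defs
  imports "HOL-Computational_Algebra.Polynomial"
begin

definition poly_iter :: "int poly \<Rightarrow> nat \<Rightarrow> int poly" where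
  "poly_iter u n = (pcompose u ^^ n) [:0, 1:]"

(* The positive integers are the intended range of the exponent, hence the condition n > 0. *)
definition nilpotent_at :: "int \<Rightarrow> int poly \<Rightarrow> bool" where
  "nilpotent_at r u \<longleftrightarrow> (\<exists>n>0. poly (poly_iter u n) r = 0)"

definition nilpotents :: "int \<Rightarrow> int poly set" where
  "nilpotents r = {u. nilpotent_at r u}"

(* Meaningful only if u is nilpotent at r; otherwise LEAST is unspecified. *)
definition nilpotency_index :: "int \<Rightarrow> int poly \<Rightarrow> nat" where
  "nilpotency_index r u = (LEAST n. n > 0 \<and> poly (poly_iter u n) r = 0)"

(* r, u(r), ..., u^(m-1)(r), 0 with m the index; the entry for k = 0 is r itself. *)
definition associated_sequence :: "int \<Rightarrow> int poly \<Rightarrow> int list" where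
  "associated_sequence r u =
     map (\<lambda>k. poly (poly_iter u k) r) [0..<nilpotency_index r u] @ [0]"

end

theory Submission
  imports Defs
begin

text \<open>
  Since \<open>x - y\<close> divides \<open>u(x) - u(y)\<close>, the increments \<open>d\<^sub>k\<close> of the orbit \<open>a\<^sub>0 = -2, \<dots>, a\<^sub>m = 0\<close> form a
  divisibility chain. Hence \<open>d\<^sub>0\<close> divides \<open>a\<^sub>m - a\<^sub>0 = 2\<close>, which leaves four values of \<open>a\<^sub>1\<close>. The last nonzero
  entry \<open>b\<close> satisfies \<open>b + 2 dvd a\<^sub>1\<close> and is divisible by every increment, and
  \<open>\<bar>b\<bar> = \<bar>d\<^sub>0\<bar>\<close> forces an arithmetic progression. These conditions leave only the listed sequences, and each
  of them determines \<open>u\<close> modulo the product of the linear factors at its nonzero entries.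
\<close>

section \<open>Iterates read off from a list of values\<close>

lemma poly_poly_iter: "poly (poly_iter u n) r = (poly u ^^ n) r"
  unfolding poly_iter_def
proof (induction n arbitrary: r)
  case 0
  show ?case by simp
next
  case (Suc n)
  then show ?case by (simp add: poly_pcompose)
qed

lemma map_poly_chain_iter:
  assumes "map f xs = tl xs @ [y]" and "k \<le> length xs" and "xs \<noteq> []"
  shows "(f ^^ k) (hd xs) = (xs @ [y]) ! k"
  using assms(2)
proof (induction k)
  case 0
  then show ?case using assms(3) by (simp add: hd_conv_nth nth_append)
next
  case (Suc k)
  then have "(f ^^ Suc k) (hd xs) = map f xs ! k" by (simp add: nth_append)
  also have "\<dots> = (tl xs @ [y]) ! k" by (simp only: assms(1))
  also have "\<dots> = (xs @ [y]) ! Suc k" using assms(3) by (cases xs) auto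
  finally show ?case .
qed

text \<open>The list equation encodes the arrows from each entry to the next, ending in 0; for a
  concrete list it simplifies to a conjunction of values of \<open>u\<close>. Only the tail must
  avoid 0 because the index counts from exponent 1.\<close>

lemma nilpotent_chain:
  assumes map: "map (poly u) xs = tl xs @ [0]" and ne: "xs \<noteq> []" and nz: "0 \<notin> set (tl xs)"
  shows "u \<in> nilpotents (hd xs)"
    and "nilpotency_index (hd xs) u = length xs"
    and "associated_sequence (hd xs) u = xs @ [0]"
proof -
  have iter: "poly (poly_iter u k) (hd xs) = (xs @ [0]) ! k" if "k \<le> length xs" for k
    using map_poly_chain_iter[OF map that ne] by (simp add: poly_poly_iter)
  have nonzero: "poly (poly_iter u k) (hd xs) \<noteq> 0" if "0 < k" "k < length xs" for k
  proof -
    have "xs ! k = tl xs ! (k - 1)" and "k - 1 < length (tl xs)"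
      using that by (auto simp: nth_tl)
    then have "xs ! k \<in> set (tl xs)" by simp
    then show ?thesis using nz iter[of k] that by (auto simp: nth_append)
  qed
  have zero: "0 < length xs" "poly (poly_iter u (length xs)) (hd xs) = 0"
    using ne iter[of "length xs"] by auto
  then show "u \<in> nilpotents (hd xs)"
    by (auto simp: nilpotents_def nilpotent_at_def)
  show index: "nilpotency_index (hd xs) u = length xs"
    unfolding nilpotency_index_def
    using zero nonzero by (intro Least_equality) (auto simp: not_less[symmetric])
  show "associated_sequence (hd xs) u = xs @ [0]"
    unfolding associated_sequence_def index
    by (auto simp: iter nth_append intro!: nth_equalityI)
qed

section \<open>Divisibility in Z[x] and in Z\<close>

lemma mult_linear_dvdI:
  fixes p q :: "'a::idom poly"
  assumes "q dvd p" and "poly p (- a) = 0" and "poly q (- a) \<noteq> 0"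
  shows "q * [:a, 1:] dvd p"
proof -
  obtain s where s: "p = q * s" using assms(1) by blast
  \<comment> \<open>In a domain the nonzero value \<open>poly q (- a)\<close> cancels. Linear
    factors are thus collected one by one, although factors such as x+2 and x+4 are not comaximal in
    Z[x].\<close>
  then have "[:- (- a), 1:] dvd s" using assms(2,3) by (simp only: poly_eq_0_iff_dvd[symmetric]) simp
  then show ?thesis unfolding s by (intro mult_dvd_mono) simp_all
qed

lemma int_dvd_le_4:
  fixes x n :: int
  assumes "x dvd n" and "0 < n" and "n \<le> 4"
  shows "x \<in> {- n, -2, -1, 1, 2, n}"
proof -
  have "\<bar>x\<bar> \<le> n" using dvd_imp_le_int[of n x] assms by simp
  \<comment> \<open>The two extra cases disappear since 0 does not divide a positive
    \<open>n\<close> and 3 does not divide 4.\<close>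
  then have "x \<in> {- n, -2, -1, 1, 2, n} \<or> x = 0 \<or> n = 4 \<and> (x = -3 \<or> x = 3)"
    using assms by auto
  then show ?thesis using assms(1,2) by auto
qed

section \<open>Orbits reaching 0 under a map that respects divisibility of differences\<close>

context
  fixes f :: "int \<Rightarrow> int" and a :: "nat \<Rightarrow> int" and m :: nat
  assumes diff_dvd: "x - y dvd f x - f y"
    and a_Suc: "a (Suc k) = f (a k)"
    and a_m: "a m = 0"
    and a_nonzero: "k < m \<Longrightarrow> a k \<noteq> 0"
begin

lemma orbit_increment_dvd: "i \<le> j \<Longrightarrow> a (Suc i) - a i dvd a (Suc j) - a j"
proof (induction j rule: dec_induct)
  case (step j)
  then show ?case using diff_dvd[of "a (Suc j)" "a j"] by (metis a_Suc dvd_trans)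
qed simp

text \<open>The difference telescopes into increments from index \<open>i\<close> on, all multiples
  of the first one.\<close>

lemma orbit_increment_dvd_diff: "i \<le> j \<Longrightarrow> a (Suc i) - a i dvd a j - a i"
proof (induction j rule: dec_induct)
  case (step j)
  have "a (Suc j) - a i = (a (Suc j) - a j) + (a j - a i)" by simp
  then show ?case using step orbit_increment_dvd[of i j] by (metis dvd_add)
qed simp

text \<open>A repetition could be shifted along the orbit and would move the zero at
  \<open>m\<close> to an earlier index.\<close>

lemma orbit_distinct:
  assumes "i < j" "j \<le> m"
  shows "a i \<noteq> a j"
proof
  assume eq: "a i = a j"
  have "a (i + k) = a (j + k)" for k
    by (induction k) (simp_all add: eq a_Suc)
  from this[of "m - j"] have "a (i + (m - j)) = 0" using assms a_m by simp
  moreover have "i + (m - j) < m" using assms by simp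
  ultimately show False using a_nonzero by blast
qed

lemma orbit_last_dvd:
  assumes "i < m"
  shows "a (Suc i) - a i dvd a (m - 1)"
  using orbit_increment_dvd[of i "m - 1"] assms a_m by simp

text \<open>Equal first and last absolute values squeeze the whole divisibility chain, so all
  increments agree up to sign. A sign change would give \<open>a i = a (Suc (Suc i))\<close>; hence
  the orbit is an arithmetic progression, and its step must point from \<open>a 0\<close> towards
  0.\<close>

lemma orbit_arithmetic:
  assumes "0 < m" and last: "\<bar>a (m - 1)\<bar> = \<bar>a 1 - a 0\<bar>"
  shows "(a 1 - a 0) * a 0 < 0"
proof -
  have abs: "\<bar>a (Suc i) - a i\<bar> = \<bar>a 1 - a 0\<bar>" if "i < m" for i
  proof -
    have "a (Suc i) - a i dvd a 1 - a 0"
      using orbit_last_dvd[OF that] last by (metis dvd_abs_iff)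
    moreover have "a 1 - a 0 dvd a (Suc i) - a i"
      using orbit_increment_dvd[of 0 i] by simp
    ultimately show ?thesis by (rule zdvd_antisym_abs)
  qed
  have const: "a (Suc i) - a i = a 1 - a 0" if "i < m" for i
    using that
  proof (induction i)
    case (Suc i)
    then have "a i \<noteq> a (Suc (Suc i))" using orbit_distinct[of i "Suc (Suc i)"] by simp
    then show ?case using Suc abs[of "Suc i"] by (auto simp: abs_if split: if_splits)
  qed simp
  have "a i = a 0 + int i * (a 1 - a 0)" if "i \<le> m" for i
    using that
  proof (induction i)
    case (Suc i)
    then show ?case using const[of i] by (simp add: algebra_simps)
  qed simp
  from this[of m] have "a 0 = - (int m * (a 1 - a 0))" using a_m by simp
  then have eq: "(a 1 - a 0) * a 0 = - (int m * (a 1 - a 0)\<^sup>2)"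
    by (metis mult.commute mult.left_commute mult_minus_right power2_eq_square)
  have "a 1 \<noteq> a 0" using orbit_distinct[of 0 1] assms(1) by simp
  then show ?thesis unfolding eq using assms(1) by simp
qed

lemma orbit_classification:
  assumes a0: "a 0 = -2"
  shows "f (-2) = 0
    \<or> f (-2) = -1 \<and> f (-1) = 0
    \<or> f (-2) = -4 \<and> f (-4) = 0
    \<or> f (-2) = -3 \<and> f (-3) = 0
    \<or> f (-2) = -4 \<and> f (-4) = -6 \<and> f (-6) = 0
    \<or> f (-2) = -3 \<and> f (-3) = -4 \<and> f (-4) = -5 \<and> f (-5) = 0"
proof (cases "f (-2) = 0")
  case False
  define b where "b = a (m - 1)"
  have a1: "a 1 = f (-2)" and a2: "a 2 = f (f (-2))" and a3: "a 3 = f (f (f (-2)))"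
    by (simp_all add: a_Suc a0 numeral_eq_Suc)
  have "m \<noteq> 0" "m \<noteq> 1" using a_m a0 a1 False by (metis neg_equal_0_iff_equal zero_neq_numeral, metis)
  then have m: "2 \<le> m" by simp
  then have b: "f b = 0" "b \<noteq> 0" using a_Suc[of "m - 1"] a_m a_nonzero[of "m - 1"] by (simp_all add: b_def)
  have b_dvd: "b + 2 dvd f (-2)" using diff_dvd[of b "-2"] b by simp
  have d0: "f (-2) + 2 dvd 2" using orbit_increment_dvd_diff[of 0 m] a_m by (simp add: a0 a1[simplified])
  have d1: "f (f (-2)) - f (-2) dvd f (-2)"
    using orbit_increment_dvd_diff[of 1 m] m a_m by (simp add: a0 a_Suc)
  have d0b: "f (-2) + 2 dvd b" using orbit_last_dvd[of 0] m by (simp add: a0 a1[simplified] b_def)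
  have d1b: "f (f (-2)) - f (-2) dvd b" using orbit_last_dvd[of 1] m by (simp add: a0 a_Suc b_def)
  \<comment> \<open>A first step downwards from -2 leads away from 0, so the orbit cannot be an
    arithmetic progression.\<close>
  have not_arith: "\<bar>b\<bar> \<noteq> \<bar>f (-2) + 2\<bar>" if "f (-2) < -2"
  proof
    assume "\<bar>b\<bar> = \<bar>f (-2) + 2\<bar>"
    then have "(f (-2) + 2) * -2 < 0"
      using orbit_arithmetic m by (simp add: a0 a1[simplified] b_def)
    then show False using that by simp
  qed
  have neq: "f (f (-2)) \<noteq> -2" using orbit_distinct[of 0 2] m by (simp add: a0 a2)
  have "f (-2) + 2 \<in> {-2, -1, 1, 2}" using int_dvd_le_4[OF d0] by simp
  then consider "f (-2) = -1" | "f (-2) = -3" | "f (-2) = -4"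
    using False by fastforce
  then show ?thesis
  proof cases
    case 1
    then have "f (-1) + 1 dvd 1" using d1 by simp
    then have "\<bar>f (-1) + 1\<bar> = 1" by (simp only: zdvd1_eq)
    \<comment> \<open>The value -2 would return to the start, which \<open>neq\<close>
      forbids.\<close>
    then have "f (-1) = 0 \<or> f (-1) = -2" by arith
    then show ?thesis using 1 neq by auto
  next
    case 2
    then have "b + 2 \<in> {-3, -2, -1, 1, 2, 3}"
      using int_dvd_le_4[of "b + 2" 3] b_dvd by simp
    then have "b \<in> {-5, -4, -3, -1, 0, 1}" by fastforce
    \<comment> \<open>Here -4 fails \<open>b_dvd\<close>, 0 is excluded, and
      \<open>not_arith\<close> removes -1 and 1.\<close>
    then have "b = -3 \<or> b = -5"
      using b_dvd not_arith b 2 by auto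
    then show ?thesis
    proof
      assume "b = -3"
      with 2 b show ?thesis by simp
    next
      assume b5: "b = -5"
      define d where "d = f (-3) + 3"
      have "d dvd 3" "d dvd 5" using d1 d1b by (simp_all add: 2 b5 d_def)
      moreover from this(1) have "d \<in> {-3, -2, -1, 1, 2, 3}"
        using int_dvd_le_4[of d 3] by simp
      ultimately have "d = -1 \<or> d = 1" by auto
      \<comment> \<open>The increment +1 would return to -2.\<close>
      then have f3: "f (-3) = -4" using neq 2 by (auto simp: d_def)
      \<comment> \<open>This makes a third increment available; it divides both -4 and
        \<open>b\<close>, so it is again 1 or -1, and +1 would return to -3.\<close>
      have "m \<noteq> 2" using a_m a2 2 f3 by auto
      then have m3: "3 \<le> m" using m by simp
      have "a 3 - a 2 dvd b"
        using orbit_last_dvd[of 2] m3 by (simp add: b_def numeral_eq_Suc)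
      moreover have "a 3 - a 2 dvd a 2"
        using orbit_increment_dvd_diff[of 2 m] m3 a_m by (simp add: numeral_eq_Suc)
      moreover define e where "e = f (-4) + 4"
      ultimately have dvd: "e dvd 5" "e dvd 4"
        by (simp_all add: a2 a3 2 f3 b5)
      have "e \<in> {-4, -2, -1, 1, 2, 4}"
        using int_dvd_le_4[OF dvd(2)] by simp
      then have "e = -1 \<or> e = 1" using dvd(1) by auto
      moreover have "f (-4) \<noteq> -3"
        using orbit_distinct[of 1 3] m3 by (simp add: a1[simplified] a3 2 f3)
      ultimately have "f (-4) = -5" by (auto simp: e_def)
      with 2 f3 b b5 show ?thesis by simp
    qed
  next
    case 3
    then have "b + 2 \<in> {-4, -2, -1, 1, 2, 4}"
      using int_dvd_le_4[of "b + 2" 4] b_dvd by simp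
    then have "b \<in> {-6, -4, -3, -1, 0, 2}" by fastforce
    \<comment> \<open>The first increment -2 forces \<open>b\<close> to be even, and
      \<open>not_arith\<close> removes 2.\<close>
    then have "b = -4 \<or> b = -6"
      using d0b not_arith b 3 by auto
    then show ?thesis
    proof
      assume "b = -4"
      with 3 b show ?thesis by simp
    next
      assume b6: "b = -6"
      define d where "d = f (-4) + 4"
      have dvd: "d dvd 4" "d dvd 6" using d1 d1b by (simp_all add: 3 b6 d_def)
      have "2 dvd d"
        using orbit_increment_dvd[of 0 1] by (simp add: a0 a_Suc 3 d_def)
      moreover have "d \<in> {-4, -2, -1, 1, 2, 4}"
        using int_dvd_le_4[OF dvd(1)] by simp
      \<comment> \<open>An even common divisor of 4 and 6; the sign + would return to -2.\<close>
      ultimately have "d = -2 \<or> d = 2" using dvd(2) by auto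
      then have "f (-4) = -6" using neq 3 by (auto simp: d_def)
      with 3 b b6 show ?thesis by simp
    qed
  qed
qed simp

end

section \<open>Possible values of a polynomial nilpotent at -2\<close>

lemma nilpotent_minus2_values:
  assumes "u \<in> nilpotents (-2)"
  shows "poly u (-2) = 0
    \<or> poly u (-2) = -1 \<and> poly u (-1) = 0
    \<or> poly u (-2) = -4 \<and> poly u (-4) = 0
    \<or> poly u (-2) = -3 \<and> poly u (-3) = 0
    \<or> poly u (-2) = -4 \<and> poly u (-4) = -6 \<and> poly u (-6) = 0
    \<or> poly u (-2) = -3 \<and> poly u (-3) = -4 \<and> poly u (-4) = -5 \<and> poly u (-5) = 0"
proof -
  define a where "a k = (poly u ^^ k) (-2)" for k
  \<comment> \<open>The candidate \<open>n = 0\<close> is harmless because \<open>a 0 = -2\<close>,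
    so \<open>m\<close> is the index of nilpotency.\<close>
  define m where "m = (LEAST n. a n = 0)"
  have ex: "\<exists>n. a n = 0"
    using assms by (auto simp: nilpotents_def nilpotent_at_def poly_poly_iter a_def)
  have dvd: "x - y dvd poly u x - poly u y" for x y
  proof (induction u)
    case (pCons c u)
    have "poly (pCons c u) x - poly (pCons c u) y = x * (poly u x - poly u y) + (x - y) * poly u y"
      by (simp add: algebra_simps)
    then show ?case using pCons.IH by simp
  qed simp
  show ?thesis
  proof (rule orbit_classification[where a = a and m = m])
    show "a m = 0" unfolding m_def using ex by (rule LeastI_ex)
    show "a k \<noteq> 0" if "k < m" for k using that not_less_Least unfolding m_def by blast
  qed (simp_all add: a_def dvd)
qed

section \<open>Prescribed values as congruences in Z[x]\<close>

lemma ex_interpolation_iff_dvd: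
  fixes u q s :: "'a::comm_ring_1 poly"
  shows "(\<exists>p. u = q + p * s) \<longleftrightarrow> s dvd u - q"
  by (auto simp: dvd_def algebra_simps)

text \<open>One polynomial with the prescribed values is subtracted; the difference vanishes at
  every node, and \<open>mult_linear_dvdI\<close> gathers the factors. The next four lemmas follow
  the same pattern.\<close>

lemma interpolation_form2_iff:
  fixes u :: "int poly"
  shows "(\<exists>p. u = [:1, 1:] + p * [:1, 1:] * [:2, 1:]) \<longleftrightarrow> poly u (-2) = -1 \<and> poly u (-1) = 0"
    (is "?L \<longleftrightarrow> ?R")
proof
  assume ?L
  then show ?R by auto
next
  assume ?R
  define v where "v = u - ([:1, 1:])"
  have "[:1, 1:] dvd v"
    using \<open>?R\<close> poly_eq_0_iff_dvd[of v "-1"] by (simp add: v_def)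
  then have "[:1, 1:] * [:2, 1:] dvd v"
    by (rule mult_linear_dvdI) (use \<open>?R\<close> in \<open>simp_all add: v_def\<close>)
  then show ?L
    using ex_interpolation_iff_dvd[of u "[:1, 1:]" "[:1, 1:] * [:2, 1:]"]
    by (simp only: v_def mult.assoc)
qed

lemma interpolation_form3_iff:
  fixes u :: "int poly"
  shows "(\<exists>p. u = - 2 * [:4, 1:] + p * [:2, 1:] * [:4, 1:]) \<longleftrightarrow> poly u (-2) = -4 \<and> poly u (-4) = 0"
    (is "?L \<longleftrightarrow> ?R")
proof
  assume ?L
  then show ?R by auto
next
  assume ?R
  define v where "v = u - (- 2 * [:4, 1:])"
  have "[:2, 1:] dvd v"
    using \<open>?R\<close> poly_eq_0_iff_dvd[of v "-2"] by (simp add: v_def)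
  then have "[:2, 1:] * [:4, 1:] dvd v"
    by (rule mult_linear_dvdI) (use \<open>?R\<close> in \<open>simp_all add: v_def\<close>)
  then show ?L
    using ex_interpolation_iff_dvd[of u "- 2 * [:4, 1:]" "[:2, 1:] * [:4, 1:]"]
    by (simp only: v_def mult.assoc)
qed

lemma interpolation_form4_iff:
  fixes u :: "int poly"
  shows "(\<exists>p. u = - 3 * [:3, 1:] + p * [:2, 1:] * [:3, 1:]) \<longleftrightarrow> poly u (-2) = -3 \<and> poly u (-3) = 0"
    (is "?L \<longleftrightarrow> ?R")
proof
  assume ?L
  then show ?R by auto
next
  assume ?R
  define v where "v = u - (- 3 * [:3, 1:])"
  have "[:2, 1:] dvd v"
    using \<open>?R\<close> poly_eq_0_iff_dvd[of v "-2"] by (simp add: v_def)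
  then have "[:2, 1:] * [:3, 1:] dvd v"
    by (rule mult_linear_dvdI) (use \<open>?R\<close> in \<open>simp_all add: v_def\<close>)
  then show ?L
    using ex_interpolation_iff_dvd[of u "- 3 * [:3, 1:]" "[:2, 1:] * [:3, 1:]"]
    by (simp only: v_def mult.assoc)
qed

text \<open>The quadratic is x - 2 + (x+2)(x+4): a step of -2 at -2 and -4, corrected to vanish at
  -6.\<close>

lemma interpolation_form5_iff:
  fixes u :: "int poly"
  shows "(\<exists>p. u = [:1, 1:] * [:6, 1:] + p * [:2, 1:] * [:4, 1:] * [:6, 1:]) \<longleftrightarrow> poly u (-2) = -4 \<and> poly u (-4) = -6 \<and> poly u (-6) = 0"
    (is "?L \<longleftrightarrow> ?R")
proof
  assume ?L
  then show ?R by auto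
next
  assume ?R
  define v where "v = u - ([:1, 1:] * [:6, 1:])"
  have "[:2, 1:] dvd v"
    using \<open>?R\<close> poly_eq_0_iff_dvd[of v "-2"] by (simp add: v_def)
  then have "[:2, 1:] * [:4, 1:] dvd v"
    by (rule mult_linear_dvdI) (use \<open>?R\<close> in \<open>simp_all add: v_def\<close>)
  then have "[:2, 1:] * [:4, 1:] * [:6, 1:] dvd v"
    by (rule mult_linear_dvdI) (use \<open>?R\<close> in \<open>simp_all add: v_def\<close>)
  then show ?L
    using ex_interpolation_iff_dvd[of u "[:1, 1:] * [:6, 1:]" "[:2, 1:] * [:4, 1:] * [:6, 1:]"]
    by (simp only: v_def mult.assoc)
qed

text \<open>The cubic is x - 1 - (x+2)(x+3)(x+4): a step of -1 at -2, -3 and -4, corrected to vanish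
  at -5.\<close>

lemma interpolation_form6_iff:
  fixes u :: "int poly"
  shows "(\<exists>p. u = - ([:5, 1:] * [:5, 4, 1:]) + p * [:2, 1:] * [:3, 1:] * [:4, 1:] * [:5, 1:]) \<longleftrightarrow> poly u (-2) = -3 \<and> poly u (-3) = -4 \<and> poly u (-4) = -5 \<and> poly u (-5) = 0"
    (is "?L \<longleftrightarrow> ?R")
proof
  assume ?L
  then show ?R by auto
next
  assume ?R
  define v where "v = u - (- ([:5, 1:] * [:5, 4, 1:]))"
  have "[:2, 1:] dvd v"
    using \<open>?R\<close> poly_eq_0_iff_dvd[of v "-2"] by (simp add: v_def)
  then have "[:2, 1:] * [:3, 1:] dvd v"
    by (rule mult_linear_dvdI) (use \<open>?R\<close> in \<open>simp_all add: v_def\<close>)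
  then have "[:2, 1:] * [:3, 1:] * [:4, 1:] dvd v"
    by (rule mult_linear_dvdI) (use \<open>?R\<close> in \<open>simp_all add: v_def\<close>)
  then have "[:2, 1:] * [:3, 1:] * [:4, 1:] * [:5, 1:] dvd v"
    by (rule mult_linear_dvdI) (use \<open>?R\<close> in \<open>simp_all add: v_def\<close>)
  then show ?L
    using ex_interpolation_iff_dvd[of u "- ([:5, 1:] * [:5, 4, 1:])" "[:2, 1:] * [:3, 1:] * [:4, 1:] * [:5, 1:]"]
    by (simp only: v_def mult.assoc)
qed

theorem corollary3p3:
  fixes u :: "int poly"
  shows "(u \<in> nilpotents (-2) \<longleftrightarrow>
      ((\<exists>p. u = [:2, 1:] * p) \<or>
       (\<exists>p. u = [:1, 1:] + p * [:1, 1:] * [:2, 1:]) \<or>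
       (\<exists>p. u = - 2 * [:4, 1:] + p * [:2, 1:] * [:4, 1:]) \<or>
       (\<exists>p. u = - 3 * [:3, 1:] + p * [:2, 1:] * [:3, 1:]) \<or>
       (\<exists>p. u = [:1, 1:] * [:6, 1:] + p * [:2, 1:] * [:4, 1:] * [:6, 1:]) \<or>
       (\<exists>p. u = - ([:5, 1:] * [:5, 4, 1:]) + p * [:2, 1:] * [:3, 1:] * [:4, 1:] * [:5, 1:])))
    \<and> ((\<exists>p. u = [:2, 1:] * p) \<longrightarrow>
         nilpotency_index (-2) u = 1 \<and> associated_sequence (-2) u = [-2, 0])
    \<and> ((\<exists>p. u = [:1, 1:] + p * [:1, 1:] * [:2, 1:]) \<longrightarrow>
         nilpotency_index (-2) u = 2 \<and> associated_sequence (-2) u = [-2, -1, 0])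
    \<and> ((\<exists>p. u = - 2 * [:4, 1:] + p * [:2, 1:] * [:4, 1:]) \<longrightarrow>
         nilpotency_index (-2) u = 2 \<and> associated_sequence (-2) u = [-2, -4, 0])
    \<and> ((\<exists>p. u = - 3 * [:3, 1:] + p * [:2, 1:] * [:3, 1:]) \<longrightarrow>
         nilpotency_index (-2) u = 2 \<and> associated_sequence (-2) u = [-2, -3, 0])
    \<and> ((\<exists>p. u = [:1, 1:] * [:6, 1:] + p * [:2, 1:] * [:4, 1:] * [:6, 1:]) \<longrightarrow>
         nilpotency_index (-2) u = 3 \<and> associated_sequence (-2) u = [-2, -4, -6, 0])
    \<and> ((\<exists>p. u = - ([:5, 1:] * [:5, 4, 1:]) + p * [:2, 1:] * [:3, 1:] * [:4, 1:] * [:5, 1:]) \<longrightarrow>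
         nilpotency_index (-2) u = 4 \<and> associated_sequence (-2) u = [-2, -3, -4, -5, 0])"
proof -
  have form1: "(\<exists>p. u = [:2, 1:] * p) \<longleftrightarrow> poly u (-2) = 0"
    using poly_eq_0_iff_dvd[of u "-2"] by (simp add: dvd_def)
  have chain1: "u \<in> nilpotents (-2) \<and> nilpotency_index (-2) u = 1
      \<and> associated_sequence (-2) u = [-2, 0]"
    if "poly u (-2) = 0"
    using that nilpotent_chain[of u "[-2]"] by simp
  have chain2: "u \<in> nilpotents (-2) \<and> nilpotency_index (-2) u = 2
      \<and> associated_sequence (-2) u = [-2, -1, 0]"
    if "poly u (-2) = -1 \<and> poly u (-1) = 0"
    using that nilpotent_chain[of u "[-2, -1]"] by simp
  have chain3: "u \<in> nilpotents (-2) \<and> nilpotency_index (-2) u = 2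
      \<and> associated_sequence (-2) u = [-2, -4, 0]"
    if "poly u (-2) = -4 \<and> poly u (-4) = 0"
    using that nilpotent_chain[of u "[-2, -4]"] by simp
  have chain4: "u \<in> nilpotents (-2) \<and> nilpotency_index (-2) u = 2
      \<and> associated_sequence (-2) u = [-2, -3, 0]"
    if "poly u (-2) = -3 \<and> poly u (-3) = 0"
    using that nilpotent_chain[of u "[-2, -3]"] by simp
  have chain5: "u \<in> nilpotents (-2) \<and> nilpotency_index (-2) u = 3
      \<and> associated_sequence (-2) u = [-2, -4, -6, 0]"
    if "poly u (-2) = -4 \<and> poly u (-4) = -6 \<and> poly u (-6) = 0"
    using that nilpotent_chain[of u "[-2, -4, -6]"] by simp
  have chain6: "u \<in> nilpotents (-2) \<and> nilpotency_index (-2) u = 4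
      \<and> associated_sequence (-2) u = [-2, -3, -4, -5, 0]"
    if "poly u (-2) = -3 \<and> poly u (-3) = -4 \<and> poly u (-4) = -5 \<and> poly u (-5) = 0"
    using that nilpotent_chain[of u "[-2, -3, -4, -5]"] by simp
  \<comment> \<open>Once every form is rewritten as a condition on values, the classification gives
    one direction and the chains give the converse, the indices and the sequences.\<close>
  show ?thesis
    unfolding form1 interpolation_form2_iff interpolation_form3_iff interpolation_form4_iff
    interpolation_form5_iff interpolation_form6_iff
    using nilpotent_minus2_values[of u] chain1 chain2 chain3 chain4 chain5 chain6 by blast
qed

end
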